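(* Let $G$ be a strongly topological gyrogroup and let $H$ be a closed first-countable and separable strong subgyrogroup of $G$. If the quotient space $G/H$ is an $\aleph_0$-space, then $G$ is also an $\aleph_0$-space.
   Context: All topological spaces are assumed Hausdorff. A gyrogroup is a nonempty set $G$ with a binary operation $\oplus$ such that: (G1) there is a unique $0\in G$ with $0\oplus a=a=a\oplus 0$ for all $a$; (G2) each $x\in G$ has a unique inverse $\ominus x$ with $\ominus x\oplus x=0=x\oplus(\ominus x)$; (G3) for all $x,y\in G$ there is an automorphism $\mathrm{gyr}[x,y]$ of $(G,\oplus)$ with $x\oplus(y\oplus z)=(x\oplus y)\oplus\mathrm{gyr}[x,y](z)$ for all $z\in G$; (G4) $\mathrm{gyr}[x\oplus y,y]=\mathrm{gyr}[x,y]$ for all $x,y\in G$. A topological gyrogroup is a gyrogroup with a topology making $\oplus:G\times G\to G$ jointly continuous and $x\mapsto\ominus x$ continuous. It is a strongly topological gyrogroup if there is a neighborhood base $\mathscr U$ of $0$ with $\mathrm{gyr}[x,y](U)=U$ for all $U\in\mathscr U$ and $x,y\in G$. A subgyrogroup is a nonempty subset $H\subseteq G$ that is a gyrogroup under the inherited operation and such that $\mathrm{gyr}[a,b]$ restricts to an automorphism of $H$ for all $a,b\in H$. It is a strong subgyrogroup if $\mathrm{gyr}[x,y](H)=H$ for all $x,y\in G$. For such $H$ the left cosets $a\oplus H$ ($a\in G$) partition $G$; $G/H=\{a\oplus H:a\in G\}$ carries the quotient topology induced by $\pi:G\to G/H$, $\pi(a)=a\oplus H$. Subgyrogroups carry the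 subspace topology. A family $\mathcal P$ of subsets of a space $X$ is a $k$-network for $X$ if whenever $K\subseteq U$ with $K$ compact and $U$ open in $X$, there is a finite $\mathcal P'\subseteq\mathcal P$ with $K\subseteq\bigcup\mathcal P'\subseteq U$. An $\aleph_0$-space is a regular space with a countable $k$-network. *)

theory Defs
  imports "HOL-Analysis.Analysis"
begin

section \<open>Gyrogroups\<close>

definition is_gyro_identity :: "'a set \<Rightarrow> ('a \<Rightarrow> 'a \<Rightarrow> 'a) \<Rightarrow> 'a \<Rightarrow> bool" where
  "is_gyro_identity G f e \<longleftrightarrow> e \<in> G \<and> (\<forall>a\<in>G. f e a = a \<and> f a e = a)"

definition gyro_zero :: "'a set \<Rightarrow> ('a \<Rightarrow> 'a \<Rightarrow> 'a) \<Rightarrow> 'a" where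
  "gyro_zero G f = (THE e. is_gyro_identity G f e)"

definition is_gyro_inverse :: "'a set \<Rightarrow> ('a \<Rightarrow> 'a \<Rightarrow> 'a) \<Rightarrow> 'a \<Rightarrow> 'a \<Rightarrow> bool" where
  "is_gyro_inverse G f x y \<longleftrightarrow> y \<in> G \<and> f y x = gyro_zero G f \<and> f x y = gyro_zero G f"

definition gyro_inv :: "'a set \<Rightarrow> ('a \<Rightarrow> 'a \<Rightarrow> 'a) \<Rightarrow> 'a \<Rightarrow> 'a" where
  "gyro_inv G f x = (THE y. is_gyro_inverse G f x y)"

definition gyro_automorphism :: "'a set \<Rightarrow> ('a \<Rightarrow> 'a \<Rightarrow> 'a) \<Rightarrow> ('a \<Rightarrow> 'a) \<Rightarrow> bool" where
  "gyro_automorphism G f h \<longleftrightarrow>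
     bij_betw h G G \<and> (\<forall>x\<in>G. \<forall>y\<in>G. h (f x y) = f (h x) (h y))"

text \<open>The gyrations are a parameter of the locale; on the carrier they are determined by the
  operation (lemma \<open>gyr_unique\<close> below), and their values outside the carrier are irrelevant.\<close>

locale gyrogroup =
  fixes G :: "'a set"
    and oplus :: "'a \<Rightarrow> 'a \<Rightarrow> 'a" (infixl "\<oplus>" 65)
    and gyr :: "'a \<Rightarrow> 'a \<Rightarrow> 'a \<Rightarrow> 'a"
  assumes nonempty: "G \<noteq> {}"
    and oplus_closed: "\<lbrakk>x \<in> G; y \<in> G\<rbrakk> \<Longrightarrow> x \<oplus> y \<in> G"
    and ex1_identity: "\<exists>!e. is_gyro_identity G (\<oplus>) e"
    and ex1_inverse: "x \<in> G \<Longrightarrow> \<exists>!y. is_gyro_inverse G (\<oplus>) x y"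
    and gyr_automorphism: "\<lbrakk>x \<in> G; y \<in> G\<rbrakk> \<Longrightarrow> gyro_automorphism G (\<oplus>) (gyr x y)"
    and gyr_assoc: "\<lbrakk>x \<in> G; y \<in> G; z \<in> G\<rbrakk> \<Longrightarrow> x \<oplus> (y \<oplus> z) = (x \<oplus> y) \<oplus> gyr x y z"
    and gyr_left_loop: "\<lbrakk>x \<in> G; y \<in> G; z \<in> G\<rbrakk> \<Longrightarrow> gyr (x \<oplus> y) y z = gyr x y z"
begin

lemma left_cancel:
  assumes "x \<in> G" "y \<in> G" "z \<in> G" "x \<oplus> y = x \<oplus> z"
  shows "y = z"
proof -
  have zero: "is_gyro_identity G (\<oplus>) (gyro_zero G (\<oplus>))"
    unfolding gyro_zero_def by (rule theI'[OF ex1_identity])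
  obtain x' where x': "x' \<in> G" "x' \<oplus> x = gyro_zero G (\<oplus>)"
    using ex1_inverse[OF assms(1)] by (auto simp: is_gyro_inverse_def)
  have auto: "gyro_automorphism G (\<oplus>) (gyr x' x)"
    using gyr_automorphism x' assms(1) by blast
  have "x' \<oplus> (x \<oplus> w) = gyr x' x w" if "w \<in> G" for w
    using gyr_assoc[OF x'(1) assms(1) that] x'(2) zero auto that
    by (auto simp: is_gyro_identity_def gyro_automorphism_def dest: bij_betwE)
  then have "gyr x' x y = gyr x' x z"
    using assms by metis
  then show ?thesis
    using auto assms(2,3) by (auto simp: gyro_automorphism_def bij_betw_def dest: inj_onD)
qed

lemma gyr_unique:
  assumes "gyrogroup G (\<oplus>) gyr'" "x \<in> G" "y \<in> G" "z \<in> G"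
  shows "gyr' x y z = gyr x y z"
proof -
  interpret g': gyrogroup G "(\<oplus>)" gyr' by fact
  have "gyr' x y z \<in> G" "gyr x y z \<in> G"
    using g'.gyr_automorphism[OF assms(2,3)] gyr_automorphism[OF assms(2,3)] assms(4)
    unfolding gyro_automorphism_def by (blast dest: bij_betwE)+
  then show ?thesis
    using left_cancel[of "x \<oplus> y"] oplus_closed g'.gyr_assoc gyr_assoc assms(2-4) by metis
qed

end

definition subgyrogroup ::
    "'a set \<Rightarrow> ('a \<Rightarrow> 'a \<Rightarrow> 'a) \<Rightarrow> ('a \<Rightarrow> 'a \<Rightarrow> 'a \<Rightarrow> 'a) \<Rightarrow> 'a set \<Rightarrow> bool" where
  "subgyrogroup G f gyr H \<longleftrightarrow>
     H \<noteq> {} \<and> H \<subseteq> G \<and> (\<exists>gyr'. gyrogroup H f gyr') \<and>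
     (\<forall>a\<in>H. \<forall>b\<in>H. gyro_automorphism H f (gyr a b))"

definition strong_subgyrogroup ::
    "'a set \<Rightarrow> ('a \<Rightarrow> 'a \<Rightarrow> 'a) \<Rightarrow> ('a \<Rightarrow> 'a \<Rightarrow> 'a \<Rightarrow> 'a) \<Rightarrow> 'a set \<Rightarrow> bool" where
  "strong_subgyrogroup G f gyr H \<longleftrightarrow>
     subgyrogroup G f gyr H \<and> (\<forall>x\<in>G. \<forall>y\<in>G. gyr x y ` H = H)"


section \<open>Topological gyrogroups\<close>

text \<open>The carrier is the underlying set of the topological space. Spaces are Hausdorff by
  convention.\<close>

locale topological_gyrogroup = gyrogroup "topspace X" oplus gyr
  for X :: "'a topology"
    and oplus :: "'a \<Rightarrow> 'a \<Rightarrow> 'a" (infixl "\<oplus>" 65)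
    and gyr :: "'a \<Rightarrow> 'a \<Rightarrow> 'a \<Rightarrow> 'a" +
  assumes Hausdorff: "Hausdorff_space X"
    and continuous_oplus: "continuous_map (prod_topology X X) X (\<lambda>(x, y). x \<oplus> y)"
    and continuous_inv: "continuous_map X X (gyro_inv (topspace X) (\<oplus>))"

text \<open>Members of the neighbourhood base are neighbourhoods of the identity, not necessarily open.\<close>

locale strongly_topological_gyrogroup = topological_gyrogroup X oplus gyr
  for X :: "'a topology"
    and oplus :: "'a \<Rightarrow> 'a \<Rightarrow> 'a" (infixl "\<oplus>" 65)
    and gyr :: "'a \<Rightarrow> 'a \<Rightarrow> 'a \<Rightarrow> 'a" +
  assumes ex_gyr_invariant_base:
    "\<exists>\<U>. (\<forall>U\<in>\<U>. U \<subseteq> topspace X \<and>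
               (\<exists>V. openin X V \<and> gyro_zero (topspace X) (\<oplus>) \<in> V \<and> V \<subseteq> U)) \<and>
          (\<forall>W. openin X W \<and> gyro_zero (topspace X) (\<oplus>) \<in> W \<longrightarrow> (\<exists>U\<in>\<U>. U \<subseteq> W)) \<and>
          (\<forall>U\<in>\<U>. \<forall>x\<in>topspace X. \<forall>y\<in>topspace X. gyr x y ` U = U)"


section \<open>The space of left cosets\<close>

definition left_coset :: "('a \<Rightarrow> 'a \<Rightarrow> 'a) \<Rightarrow> 'a set \<Rightarrow> 'a \<Rightarrow> 'a set" where
  "left_coset f H a = f a ` H"

definition coset_space :: "'a topology \<Rightarrow> ('a \<Rightarrow> 'a \<Rightarrow> 'a) \<Rightarrow> 'a set \<Rightarrow> 'a set topology" where
  "coset_space X f H =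
     topology (\<lambda>V. V \<subseteq> left_coset f H ` topspace X \<and>
                   openin X {x \<in> topspace X. left_coset f H x \<in> V})"

lemma openin_coset_space:
  "openin (coset_space X f H) V \<longleftrightarrow>
     V \<subseteq> left_coset f H ` topspace X \<and> openin X {x \<in> topspace X. left_coset f H x \<in> V}"
proof -
  let ?\<pi> = "left_coset f H"
  let ?P = "\<lambda>V. V \<subseteq> ?\<pi> ` topspace X \<and> openin X {x \<in> topspace X. ?\<pi> x \<in> V}"
  have "istopology ?P"
    unfolding istopology_def
  proof (intro conjI allI impI)
    fix S T assume "?P S" "?P T"
    moreover have "{x \<in> topspace X. ?\<pi> x \<in> S \<inter> T} =
        {x \<in> topspace X. ?\<pi> x \<in> S} \<inter> {x \<in> topspace X. ?\<pi> x \<in> T}" by blast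
    ultimately show "S \<inter> T \<subseteq> ?\<pi> ` topspace X" "openin X {x \<in> topspace X. ?\<pi> x \<in> S \<inter> T}"
      by auto
  next
    fix \<K> assume "\<forall>K\<in>\<K>. ?P K"
    moreover have "{x \<in> topspace X. ?\<pi> x \<in> \<Union>\<K>} = (\<Union>K\<in>\<K>. {x \<in> topspace X. ?\<pi> x \<in> K})"
      by blast
    ultimately show "\<Union>\<K> \<subseteq> ?\<pi> ` topspace X" "openin X {x \<in> topspace X. ?\<pi> x \<in> \<Union>\<K>}"
      by auto
  qed
  then show ?thesis
    unfolding coset_space_def by (simp add: topology_inverse')
qed

lemma topspace_coset_space: "topspace (coset_space X f H) = left_coset f H ` topspace X"
proof
  show "topspace (coset_space X f H) \<subseteq> left_coset f H ` topspace X"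
    by (auto simp: topspace_def openin_coset_space)
  have "{x \<in> topspace X. left_coset f H x \<in> left_coset f H ` topspace X} = topspace X" by blast
  then show "left_coset f H ` topspace X \<subseteq> topspace (coset_space X f H)"
    by (intro openin_subset) (simp add: openin_coset_space)
qed

lemma quotient_map_left_coset: "quotient_map X (coset_space X f H) (left_coset f H)"
  by (simp add: quotient_map_def topspace_coset_space openin_coset_space)


section \<open>Networks\<close>

definition k_network :: "'a topology \<Rightarrow> 'a set set \<Rightarrow> bool" where
  "k_network X \<P> \<longleftrightarrow>
     (\<forall>P\<in>\<P>. P \<subseteq> topspace X) \<and>
     (\<forall>K U. compactin X K \<and> openin X U \<and> K \<subseteq> U \<longrightarrow>
        (\<exists>\<P>'. finite \<P>' \<and> \<P>' \<subseteq> \<P> \<and> K \<subseteq> \<Union>\<P>' \<and> \<Union>\<P>' \<subseteq> U))"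

text \<open>\<open>regular_space\<close> does not include any point separation, hence the explicit Hausdorff
  condition.\<close>

definition aleph0_space :: "'a topology \<Rightarrow> bool" where
  "aleph0_space X \<longleftrightarrow>
     Hausdorff_space X \<and> regular_space X \<and> (\<exists>\<P>. countable \<P> \<and> k_network X \<P>)"

end

theory Submission
  imports Defs
begin

text \<open>Choose a countable family \<open>\<U>\<close> of gyration-invariant open neighbourhoods of \<open>0\<close>
  whose traces on \<open>H\<close> form a base at \<open>0\<close> in \<open>H\<close> and which is closed under passing to
  \<open>U'\<close> with \<open>U' \<oplus> U' \<subseteq> U\<close> and \<open>\<ominus>U' \<oplus> U' \<subseteq> U\<close>. If \<open>w\<close> is close to \<open>0\<close>, \<open>w\<close> and \<open>u\<close> lie in
  \<open>U'\<close>, and \<open>u = w \<oplus> h\<close> with \<open>h \<in> H\<close>, then \<open>h = \<ominus>w \<oplus> u\<close> lies in \<open>U \<inter> H\<close> and is therefore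
  small, and so is \<open>u\<close>. Hence the sets \<open>(x \<oplus> U) \<inter> \<pi>\<^sup>-\<^sup>1(W)\<close>, with \<open>U\<close> in \<open>\<U>\<close> and
  \<open>W\<close> open in \<open>G/H\<close>, form a neighbourhood base at \<open>x\<close>. As \<open>G\<close> is separable, countably many
  translates \<open>s \<oplus> U\<close> suffice, and intersecting them with the preimages of a countable
  \<open>k\<close>-network of \<open>G/H\<close> gives a countable \<open>k\<close>-network of \<open>G\<close>.\<close>

section \<open>Networks\<close>

lemma k_networkE:
  assumes "k_network X \<P>" "compactin X K" "openin X U" "K \<subseteq> U"
  obtains \<F> where "finite \<F>" "\<F> \<subseteq> \<P>" "K \<subseteq> \<Union>\<F>" "\<Union>\<F> \<subseteq> U"
proof -
  have "\<forall>K U. compactin X K \<and> openin X U \<and> K \<subseteq> U \<longrightarrow>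
      (\<exists>\<F>. finite \<F> \<and> \<F> \<subseteq> \<P> \<and> K \<subseteq> \<Union>\<F> \<and> \<Union>\<F> \<subseteq> U)"
    using assms(1) unfolding k_network_def by (rule conjunct2)
  from this[rule_format, OF conjI[OF assms(2) conjI[OF assms(3,4)]]] show thesis
    by (elim exE conjE) (rule that)
qed

text \<open>Singletons are compact, so every point of an open set lies in a member of the family
  that is contained in that set. One point chosen from each nonempty member therefore gives a
  countable dense set.\<close>

lemma k_network_imp_separable_space:
  assumes "countable \<P>" and "k_network X \<P>"
  shows "separable_space X"
proof -
  define p where "p P = (SOME x. x \<in> P)" for P :: "'a set"
  have p: "p P \<in> P" if "P \<noteq> {}" for P
    using that unfolding p_def by (simp add: some_in_eq)
  let ?C = "p ` (\<P> - {{}})"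
  have "\<forall>P\<in>\<P>. P \<subseteq> topspace X"
    using assms(2) unfolding k_network_def by (rule conjunct1)
  then have C: "?C \<subseteq> topspace X"
    using p by blast
  have "?C \<inter> V \<noteq> {}" if V: "openin X V" "V \<noteq> {}" for V
  proof -
    from V obtain x where x: "x \<in> V" by blast
    then have "compactin X {x}" "{x} \<subseteq> V"
      using openin_subset[OF V(1)] by auto
    then obtain \<F> where \<F>: "finite \<F>" "\<F> \<subseteq> \<P>" "{x} \<subseteq> \<Union>\<F>" "\<Union>\<F> \<subseteq> V"
      by (rule k_networkE[OF assms(2) _ V(1)])
    from \<F>(3) obtain P where P: "P \<in> \<F>" "x \<in> P" by auto
    have "p P \<in> P"
      using p P(2) by auto
    moreover have "P \<subseteq> V" "P \<in> \<P> - {{}}"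
      using P \<F>(2,4) by auto
    ultimately show ?thesis by auto
  qed
  then have "X closure_of ?C = topspace X"
    by (simp add: dense_intersects_open)
  moreover have "countable ?C"
    using assms(1) by simp
  ultimately show ?thesis
    using C unfolding separable_space_def by (intro exI[of _ ?C] conjI)
qed

lemma regular_space_shrinkE:
  assumes "regular_space X" "openin X U" "x \<in> U"
  obtains T C where "openin X T" "closedin X C" "x \<in> T" "T \<subseteq> C" "C \<subseteq> U"
proof -
  have "neighbourhood_base_of (closedin X) X"
    using assms(1) by (simp add: neighbourhood_base_of_closedin)
  from this[unfolded neighbourhood_base_of, rule_format, OF conjI[OF assms(2,3)]]
  show thesis
    by (elim exE conjE) (rule that)
qed

text \<open>The network consists of the sets \<open>A\<close> cut by preimages of members of the
  network of \<open>Y\<close>. Near each point of a compact \<open>K\<close>, regularity shrinks a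
  basic neighbourhood to a closed set, and finitely many such pieces cover that part of
  \<open>K\<close>; compactness of \<open>K\<close> then leaves finitely many local solutions to
  combine.\<close>

lemma countable_k_network_pullback:
  assumes reg: "regular_space X"
    and cont: "continuous_map X Y f"
    and \<A>: "countable \<A>"
    and \<P>: "countable \<P>" "k_network Y \<P>"
    and base: "\<And>x V. \<lbrakk>openin X V; x \<in> V\<rbrakk> \<Longrightarrow>
      \<exists>A\<in>\<A>. \<exists>W. openin X A \<and> openin Y W \<and> x \<in> A \<and> f x \<in> W \<and>
        {z \<in> A. f z \<in> W} \<subseteq> V"
  shows "\<exists>\<Q>. countable \<Q> \<and> k_network X \<Q>"
proof -
  define piece where "piece = (\<lambda>(A, P). {z \<in> topspace X. z \<in> A \<and> f z \<in> P})"
  define \<Q> where "\<Q> = piece ` (\<A> \<times> \<P>)"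
  have "countable \<Q>"
    unfolding \<Q>_def using \<A> \<P>(1) by simp
  moreover have "k_network X \<Q>"
    unfolding k_network_def
  proof (intro conjI allI impI)
    show "\<forall>Q\<in>\<Q>. Q \<subseteq> topspace X"
      by (auto simp: \<Q>_def piece_def)
  next
    fix K V assume "compactin X K \<and> openin X V \<and> K \<subseteq> V"
    then have K: "compactin X K" and V: "openin X V" and KV: "K \<subseteq> V" by auto
    let ?good = "\<lambda>T \<F>. finite \<F> \<and> \<F> \<subseteq> \<Q> \<and> K \<inter> T \<subseteq> \<Union>\<F> \<and> \<Union>\<F> \<subseteq> V"
    have local: "\<exists>T. openin X T \<and> x \<in> T \<and> (\<exists>\<F>. ?good T \<F>)" if "x \<in> K" for x
    proof -
      from base[OF V] that KV obtain A W where AW: "A \<in> \<A>" "openin X A" "openin Y W"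
          "x \<in> A" "f x \<in> W" "{z \<in> A. f z \<in> W} \<subseteq> V" by blast
      let ?B = "A \<inter> {z \<in> topspace X. f z \<in> W}"
      have "openin X ?B"
        using AW openin_continuous_map_preimage[OF cont] by blast
      moreover have "x \<in> ?B"
        using AW openin_subset by blast
      ultimately obtain T C where TC: "openin X T" "closedin X C" "x \<in> T" "T \<subseteq> C" "C \<subseteq> ?B"
        by (rule regular_space_shrinkE[OF reg])
      \<comment> \<open>Closedness of \<open>C\<close> makes \<open>C \<inter> K\<close> compact, so
        its image is a compact subset of \<open>W\<close>. This is why \<open>?B\<close> was first
        shrunk to a closed set.\<close>
      have "compactin Y (f ` (C \<inter> K))"
        using closed_Int_compactin[OF TC(2) K] cont image_compactin by blast
      moreover have "f ` (C \<inter> K) \<subseteq> W"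
        using TC by blast
      ultimately obtain \<G> where \<G>: "finite \<G>" "\<G> \<subseteq> \<P>" "f ` (C \<inter> K) \<subseteq> \<Union>\<G>" "\<Union>\<G> \<subseteq> W"
        by (rule k_networkE[OF \<P>(2) _ AW(3)])
      let ?\<F> = "(\<lambda>P. piece (A, P)) ` \<G>"
      have "finite ?\<F>" "?\<F> \<subseteq> \<Q>"
        using \<G> AW(1) by (auto simp: \<Q>_def)
      moreover have "K \<inter> T \<subseteq> \<Union>?\<F>"
      proof
        fix z assume z: "z \<in> K \<inter> T"
        then have "z \<in> C" "z \<in> A" "z \<in> topspace X" using TC by auto
        moreover from this z obtain P where "P \<in> \<G>" "f z \<in> P" using \<G>(3) by blast
        ultimately show "z \<in> \<Union>?\<F>" by (auto simp: piece_def)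
      qed
      moreover have "\<Union>?\<F> \<subseteq> V"
        using \<G>(4) AW(6) by (auto simp: piece_def)
      ultimately show ?thesis
        using TC(1,3) by (intro exI[of _ T] exI[of _ ?\<F>] conjI)
    qed
    let ?\<C> = "{T. openin X T \<and> (\<exists>\<F>. ?good T \<F>)}"
    have "K \<subseteq> \<Union>?\<C>"
    proof
      fix x assume "x \<in> K"
      from local[OF this] show "x \<in> \<Union>?\<C>" by auto
    qed
    then obtain \<T> where \<T>: "finite \<T>" "\<T> \<subseteq> ?\<C>" "K \<subseteq> \<Union>\<T>"
      using K[unfolded compactin_def, THEN conjunct2, THEN spec, of ?\<C>] by auto
    have "\<forall>T\<in>\<T>. \<exists>\<F>. ?good T \<F>"
      using \<T>(2) by auto
    from bchoice[OF this] obtain \<F> where \<F>: "\<forall>T\<in>\<T>. ?good T (\<F> T)" ..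
    let ?\<Q> = "\<Union>(\<F> ` \<T>)"
    have "finite ?\<Q>" "?\<Q> \<subseteq> \<Q>" "\<Union>?\<Q> \<subseteq> V"
      using \<T>(1) \<F> by auto
    moreover have "K \<subseteq> \<Union>?\<Q>"
    proof
      fix x assume x: "x \<in> K"
      with \<T>(3) obtain T where "T \<in> \<T>" "x \<in> T" by auto
      with x \<F> show "x \<in> \<Union>?\<Q>" by fastforce
    qed
    ultimately show "\<exists>\<P>'. finite \<P>' \<and> \<P>' \<subseteq> \<Q> \<and> K \<subseteq> \<Union>\<P>' \<and> \<Union>\<P>' \<subseteq> V"
      by (intro exI[of _ ?\<Q>] conjI)
  qed
  ultimately show ?thesis
    by (intro exI[of _ \<Q>] conjI)
qed


section \<open>Cancellation in gyrogroups\<close>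

context gyrogroup
begin

abbreviation zero :: 'a where
  "zero \<equiv> gyro_zero G (\<oplus>)"

abbreviation neg :: "'a \<Rightarrow> 'a" where
  "neg \<equiv> gyro_inv G (\<oplus>)"

lemma is_gyro_identity_zero: "is_gyro_identity G (\<oplus>) zero"
  unfolding gyro_zero_def by (rule theI'[OF ex1_identity])

lemma zero_closed [simp]: "zero \<in> G"
  and zero_left [simp]: "a \<in> G \<Longrightarrow> zero \<oplus> a = a"
  and zero_right [simp]: "a \<in> G \<Longrightarrow> a \<oplus> zero = a"
  using is_gyro_identity_zero by (auto simp: is_gyro_identity_def)

lemma is_gyro_inverse_neg: "x \<in> G \<Longrightarrow> is_gyro_inverse G (\<oplus>) x (neg x)"
  unfolding gyro_inv_def by (rule theI'[OF ex1_inverse])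

lemma neg_closed [simp]: "x \<in> G \<Longrightarrow> neg x \<in> G"
  and neg_left [simp]: "x \<in> G \<Longrightarrow> neg x \<oplus> x = zero"
  and neg_right [simp]: "x \<in> G \<Longrightarrow> x \<oplus> neg x = zero"
  using is_gyro_inverse_neg[of x] by (auto simp: is_gyro_inverse_def)

lemma neg_neg [simp]: "x \<in> G \<Longrightarrow> neg (neg x) = x"
  using left_cancel[of "neg x" "neg (neg x)" x] by simp

lemma neg_zero [simp]: "neg zero = zero"
  using neg_left[OF zero_closed] zero_right[OF neg_closed[OF zero_closed]] by argo

lemma gyr_closed [simp]: "\<lbrakk>x \<in> G; y \<in> G; z \<in> G\<rbrakk> \<Longrightarrow> gyr x y z \<in> G"
  using gyr_automorphism[of x y] unfolding gyro_automorphism_def by (blast dest: bij_betwE)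

lemma gyr_zero_left [simp]: "\<lbrakk>y \<in> G; z \<in> G\<rbrakk> \<Longrightarrow> gyr zero y z = z"
  using gyr_assoc[of zero y z] left_cancel[of y z "gyr zero y z"] by (simp add: oplus_closed)

text \<open>The loop property turns \<open>gyr (neg x) x\<close> into \<open>gyr zero x\<close>,
  which is the identity, so the gyration disappears from gyroassociativity.\<close>

lemma neg_oplus_cancel [simp]: "\<lbrakk>x \<in> G; y \<in> G\<rbrakk> \<Longrightarrow> neg x \<oplus> (x \<oplus> y) = y"
  using gyr_assoc[of "neg x" x y] gyr_left_loop[of "neg x" x y] by simp

lemma oplus_neg_cancel [simp]: "\<lbrakk>x \<in> G; y \<in> G\<rbrakk> \<Longrightarrow> x \<oplus> (neg x \<oplus> y) = y"
  using neg_oplus_cancel[of "neg x" y] by simp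

end


section \<open>Left cosets\<close>

locale gyrogroup_with_strong_subgyrogroup = gyrogroup +
  fixes H :: "'a set"
  assumes strong: "strong_subgyrogroup G (\<oplus>) gyr H"
begin

abbreviation coset :: "'a \<Rightarrow> 'a set" where
  "coset \<equiv> left_coset (\<oplus>) H"

lemma subset_carrier: "H \<subseteq> G"
  using strong by (auto simp: strong_subgyrogroup_def subgyrogroup_def)

lemma gyr_image: "\<lbrakk>x \<in> G; y \<in> G\<rbrakk> \<Longrightarrow> gyr x y ` H = H"
  using strong by (auto simp: strong_subgyrogroup_def)

lemma zero_mem: "zero \<in> H"
  and oplus_image: "h \<in> H \<Longrightarrow> (\<oplus>) h ` H = H"
proof -
  obtain gyr' where "gyrogroup H (\<oplus>) gyr'"
    using strong by (auto simp: strong_subgyrogroup_def subgyrogroup_def)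
  then interpret S: gyrogroup H "(\<oplus>)" gyr' .
  have "S.zero \<in> G"
    using subset_carrier S.zero_closed by blast
  \<comment> \<open>The identity \<open>e\<close> of \<open>H\<close> satisfies
    \<open>e \<oplus> e = e = e \<oplus> zero\<close>, and \<open>e\<close> cancels in
    \<open>G\<close>.\<close>
  then have "S.zero = zero"
    using left_cancel[of S.zero S.zero zero] by simp
  then show "zero \<in> H"
    using S.zero_closed by simp
  show "(\<oplus>) h ` H = H" if h: "h \<in> H"
  proof
    show "(\<oplus>) h ` H \<subseteq> H"
      using S.oplus_closed h by blast
    show "H \<subseteq> (\<oplus>) h ` H"
    proof
      fix k assume "k \<in> H"
      with h have "k = h \<oplus> (S.neg h \<oplus> k)" "S.neg h \<oplus> k \<in> H"
        by (simp_all add: S.oplus_closed)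
      then show "k \<in> (\<oplus>) h ` H" by blast
    qed
  qed
qed

text \<open>Gyroassociativity turns \<open>x \<oplus> (y \<oplus> h)\<close> into
  \<open>(x \<oplus> y) \<oplus> gyr x y h\<close>, and \<open>gyr x y\<close> maps \<open>H\<close>
  onto itself because \<open>H\<close> is strong.\<close>

lemma coset_oplus_left:
  assumes "x \<in> G" "y \<in> G"
  shows "coset (x \<oplus> y) = (\<oplus>) x ` coset y"
proof -
  have "(\<oplus>) x ` coset y = (\<lambda>h. (x \<oplus> y) \<oplus> gyr x y h) ` H"
    unfolding left_coset_def image_image
    using gyr_assoc[OF assms] subset_carrier by (intro image_cong) auto
  also have "\<dots> = (\<oplus>) (x \<oplus> y) ` gyr x y ` H"
    by (simp add: image_image)
  finally show ?thesis
    by (simp add: gyr_image[OF assms] left_coset_def)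
qed

lemma coset_oplus_right:
  assumes "x \<in> G" "h \<in> H"
  shows "coset (x \<oplus> h) = coset x"
  using assms subset_carrier oplus_image[OF assms(2)]
  by (subst coset_oplus_left) (auto simp: left_coset_def)

lemma coset_eqE:
  assumes "x \<in> G" "y \<in> G" "coset x = coset y"
  obtains h where "h \<in> H" "x = y \<oplus> h"
proof -
  have "x \<oplus> zero \<in> coset x"
    using zero_mem by (auto simp: left_coset_def simp del: zero_right)
  with assms that show thesis by (auto simp: left_coset_def)
qed

text \<open>Left translation by \<open>x\<close> carries the coset of \<open>u\<close> to that of
  \<open>x \<oplus> u\<close> and is injective, so \<open>x\<close> can be cancelled from the
  equality of cosets.\<close>

lemma coset_translate_eqE:
  assumes "x \<in> G" "u \<in> G" "w \<in> G" "coset (x \<oplus> u) = coset (x \<oplus> w)"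
  obtains h where "h \<in> H" "u = w \<oplus> h"
proof -
  have "(\<oplus>) x ` coset u = (\<oplus>) x ` coset w"
    using assms by (simp flip: coset_oplus_left)
  moreover have "coset u \<subseteq> G" "coset w \<subseteq> G"
    using assms subset_carrier by (auto simp: left_coset_def intro: oplus_closed)
  moreover have "inj_on ((\<oplus>) x) G"
    using left_cancel assms(1) by (auto intro!: inj_onI)
  ultimately have "coset u = coset w"
    by (simp add: inj_on_image_eq_iff)
  with assms that show thesis by (metis coset_eqE)
qed

end


section \<open>Topological gyrogroups\<close>

context topological_gyrogroup
begin

lemma continuous_map_oplus:
  assumes "continuous_map Z X f" "continuous_map Z X g"
  shows "continuous_map Z X (\<lambda>z. f z \<oplus> g z)"
  using continuous_map_compose[OF _ continuous_oplus, of Z "\<lambda>z. (f z, g z)"] assms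
  by (simp add: continuous_map_pairwise o_def)

lemma continuous_map_neg:
  "continuous_map Z X f \<Longrightarrow> continuous_map Z X (\<lambda>z. neg (f z))"
  using continuous_map_compose[OF _ continuous_inv] by (simp add: o_def)

lemmas continuous_map_gyro_intros =
  continuous_map_oplus continuous_map_neg continuous_map_const[THEN iffD2]
  continuous_map_id[unfolded id_def]

lemma openin_translate_preimage:
  assumes "openin X U" "s \<in> topspace X"
  shows "openin X {z \<in> topspace X. s \<oplus> z \<in> U}"
    and "openin X {z \<in> topspace X. z \<oplus> s \<in> U}"
    and "openin X {z \<in> topspace X. neg z \<oplus> s \<in> U}"
  using assms
  by (intro openin_continuous_map_preimage[OF _ assms(1)] continuous_map_gyro_intros; simp)+

text \<open>Translation by \<open>neg s\<close> inverts translation by \<open>s\<close>, so the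
  image is a preimage under a continuous map.\<close>

lemma openin_translate:
  assumes "openin X U" "s \<in> topspace X"
  shows "openin X ((\<oplus>) s ` U)"
proof -
  have "(\<oplus>) s ` U = {z \<in> topspace X. neg s \<oplus> z \<in> U}"
  proof (intro equalityI subsetI)
    fix z assume "z \<in> {z \<in> topspace X. neg s \<oplus> z \<in> U}"
    then have "z = s \<oplus> (neg s \<oplus> z)" "neg s \<oplus> z \<in> U"
      using assms(2) by auto
    then show "z \<in> (\<oplus>) s ` U" by blast
  qed (use assms openin_subset oplus_closed in fastforce)
  then show ?thesis
    using openin_translate_preimage(1)[OF assms(1) neg_closed[OF assms(2)]] by simp
qed

text \<open>Left cancellation expresses a gyration through the operation alone: \<open>gyr x y z =
  neg (x \<oplus> y) \<oplus> (x \<oplus> (y \<oplus> z))\<close>.\<close>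

lemma continuous_map_gyr:
  assumes "x \<in> topspace X" "y \<in> topspace X"
  shows "continuous_map X X (gyr x y)"
proof -
  have "gyr x y z = neg (x \<oplus> y) \<oplus> (x \<oplus> (y \<oplus> z))" if "z \<in> topspace X" for z
    using that assms by (simp add: gyr_assoc[OF assms] oplus_closed)
  moreover have "continuous_map X X (\<lambda>z. neg (x \<oplus> y) \<oplus> (x \<oplus> (y \<oplus> z)))"
    by (intro continuous_map_gyro_intros) (use assms oplus_closed in auto)
  ultimately show ?thesis
    by (metis (no_types, lifting) continuous_map_eq)
qed

lemma ex_neighbourhood_prod:
  assumes F: "continuous_map (prod_topology X X) X (\<lambda>(u, v). F u v)"
    and W: "openin X W" "F zero zero \<in> W"
  obtains V where "openin X V" "zero \<in> V" "\<And>u v. \<lbrakk>u \<in> V; v \<in> V\<rbrakk> \<Longrightarrow> F u v \<in> W"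
proof -
  let ?P = "{p \<in> topspace (prod_topology X X). (case p of (u, v) \<Rightarrow> F u v) \<in> W}"
  have "openin (prod_topology X X) ?P"
    using openin_continuous_map_preimage[OF F W(1)] .
  moreover have "(zero, zero) \<in> ?P"
    using W by simp
  ultimately obtain A B where AB: "openin X A" "openin X B" "zero \<in> A" "zero \<in> B" "A \<times> B \<subseteq> ?P"
    unfolding openin_prod_topology_alt by meson
  show thesis
    by (rule that[of "A \<inter> B"]) (use AB in auto)
qed

lemma ex_neighbourhood_oplus:
  assumes "openin X W" "zero \<in> W"
  obtains V where "openin X V" "zero \<in> V" "\<And>u v. \<lbrakk>u \<in> V; v \<in> V\<rbrakk> \<Longrightarrow> u \<oplus> v \<in> W"
  by (rule ex_neighbourhood_prod[OF continuous_oplus assms(1)]) (use assms in auto)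

lemma ex_neighbourhood_diff:
  assumes "openin X W" "zero \<in> W"
  obtains V where "openin X V" "zero \<in> V" "\<And>u v. \<lbrakk>u \<in> V; v \<in> V\<rbrakk> \<Longrightarrow> neg u \<oplus> v \<in> W"
proof (rule ex_neighbourhood_prod[where F = "\<lambda>u v. neg u \<oplus> v", OF _ assms(1)])
  show "continuous_map (prod_topology X X) X (\<lambda>(u, v). neg u \<oplus> v)"
    unfolding case_prod_unfold
    by (intro continuous_map_gyro_intros continuous_map_fst continuous_map_snd)
qed (use assms in auto)

end

section \<open>Openness of the quotient projection and separability of the gyrogroup\<close>

locale topological_gyrogroup_with_strong_subgyrogroup =
  topological_gyrogroup X oplus gyr +
  gyrogroup_with_strong_subgyrogroup "topspace X" oplus gyr H
  for X :: "'a topology" and oplus (infixl "\<oplus>" 65) and gyr and H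
begin

text \<open>The saturation of \<open>U\<close> is the union over \<open>h \<in> H\<close> of the
  preimages of \<open>U\<close> under the right translations by \<open>h\<close>. Their continuity
  is enough; they need not be open maps.\<close>

lemma openin_coset_image:
  assumes U: "openin X U"
  shows "openin (coset_space X (\<oplus>) H) (coset ` U)"
proof -
  have "{x \<in> topspace X. coset x \<in> coset ` U} = (\<Union>h\<in>H. {x \<in> topspace X. x \<oplus> h \<in> U})"
  proof (intro equalityI subsetI)
    fix x assume "x \<in> {x \<in> topspace X. coset x \<in> coset ` U}"
    then obtain u where x: "x \<in> topspace X" and u: "u \<in> U" "coset u = coset x" by auto
    then obtain h where "h \<in> H" "u = x \<oplus> h"
      using coset_eqE openin_subset[OF U] by (metis subsetD)
    with x u show "x \<in> (\<Union>h\<in>H. {x \<in> topspace X. x \<oplus> h \<in> U})" by auto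
  next
    fix x assume "x \<in> (\<Union>h\<in>H. {x \<in> topspace X. x \<oplus> h \<in> U})"
    then obtain h where "x \<in> topspace X" "h \<in> H" "x \<oplus> h \<in> U" by auto
    then show "x \<in> {x \<in> topspace X. coset x \<in> coset ` U}"
      using coset_oplus_right by blast
  qed
  moreover have "openin X (\<Union>h\<in>H. {x \<in> topspace X. x \<oplus> h \<in> U})"
    using openin_translate_preimage(2)[OF U] subset_carrier by blast
  ultimately show ?thesis
    using openin_subset[OF U] by (auto simp: openin_coset_space)
qed

text \<open>The sums \<open>e \<oplus> d\<close> are dense, where \<open>e\<close> runs through
  representatives of a dense set of cosets and \<open>d\<close> through a dense subset of
  \<open>H\<close>. An open \<open>N\<close> projects to an open set, so it contains some
  \<open>e \<oplus> h\<close> with \<open>h \<in> H\<close>; then \<open>h\<close> can be moved to a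
  nearby \<open>d\<close>.\<close>

lemma separable_space_extension:
  assumes "separable_space (subtopology X H)" "separable_space (coset_space X (\<oplus>) H)"
  shows "separable_space X"
proof -
  obtain D where D: "countable D" "D \<subseteq> topspace (subtopology X H)"
      "subtopology X H closure_of D = topspace (subtopology X H)"
    using assms(1) unfolding separable_space_def by blast
  obtain C where C: "countable C" "C \<subseteq> coset ` topspace X"
      "coset_space X (\<oplus>) H closure_of C = topspace (coset_space X (\<oplus>) H)"
    using assms(2) unfolding separable_space_def topspace_coset_space by blast
  obtain E where E: "countable E" "E \<subseteq> topspace X" "C = coset ` E"
    using C(1,2) by (metis countable_subset_image)
  let ?S = "(\<lambda>(e, d). e \<oplus> d) ` (E \<times> D)"
  have "?S \<inter> N \<noteq> {}" if N: "openin X N" "N \<noteq> {}" for N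
  proof -
    have "C \<inter> coset ` N \<noteq> {}"
      using C(3) openin_coset_image[OF N(1)] N(2) by (simp add: dense_intersects_open)
    with E(3) obtain e n where en: "e \<in> E" "n \<in> N" "coset n = coset e" by auto
    then obtain h where h: "h \<in> H" "n = e \<oplus> h"
      using coset_eqE E(2) openin_subset[OF N(1)] by (metis subsetD)
    let ?M = "{z \<in> topspace X. e \<oplus> z \<in> N}"
    have "openin X ?M"
      using openin_translate_preimage(1)[OF N(1)] en(1) E(2) by blast
    then have "openin (subtopology X H) (H \<inter> ?M)"
      by (auto simp: openin_subtopology)
    moreover have "h \<in> H \<inter> ?M"
      using h en(2) subset_carrier by blast
    ultimately have "D \<inter> (H \<inter> ?M) \<noteq> {}"
      using D(3) unfolding dense_intersects_open by blast
    with en(1) show ?thesis by auto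
  qed
  then have "X closure_of ?S = topspace X"
    by (simp add: dense_intersects_open)
  moreover have "countable ?S" "?S \<subseteq> topspace X"
    using D(1,2) E(1,2) by (auto intro: oplus_closed)
  ultimately show ?thesis
    unfolding separable_space_def by blast
qed

end

section \<open>Gyration-invariant neighbourhoods and regularity\<close>

context strongly_topological_gyrogroup
begin

text \<open>Half of the invariance under gyrations suffices: it allows \<open>(x \<oplus> t) \<oplus> u\<close> with
  \<open>u \<in> U\<close> to be rewritten as \<open>x \<oplus> (t \<oplus> u')\<close> with \<open>u' \<in> U\<close>.\<close>

definition gyr_neighbourhood :: "'a set \<Rightarrow> bool" where
  "gyr_neighbourhood U \<longleftrightarrow> openin X U \<and> zero \<in> U \<and>
     (\<forall>x\<in>topspace X. \<forall>y\<in>topspace X. U \<subseteq> gyr x y ` U)"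

lemma gyr_neighbourhood_reassoc:
  assumes "gyr_neighbourhood U" "x \<in> topspace X" "t \<in> topspace X" "u \<in> U"
  obtains u' where "u' \<in> U" "(x \<oplus> t) \<oplus> u = x \<oplus> (t \<oplus> u')"
proof -
  obtain u' where "u' \<in> U" "u = gyr x t u'"
    using assms unfolding gyr_neighbourhood_def by blast
  moreover have "u' \<in> topspace X"
    using assms(1) \<open>u' \<in> U\<close> openin_subset unfolding gyr_neighbourhood_def by blast
  ultimately show thesis
    using that gyr_assoc assms(2,3) by metis
qed

text \<open>Members of the given base need not be open, so the interior of such an \<open>N\<close>
  is taken. The preimage of the interior under a gyration is open and lies in \<open>N\<close> by
  invariance and injectivity, hence lies in the interior; surjectivity then gives the required
  inclusion.\<close>

lemma ex_gyr_neighbourhood: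
  assumes "openin X W" "zero \<in> W"
  obtains U where "gyr_neighbourhood U" "U \<subseteq> W"
proof -
  obtain N V where N: "N \<subseteq> topspace X" "N \<subseteq> W"
      "\<And>x y. \<lbrakk>x \<in> topspace X; y \<in> topspace X\<rbrakk> \<Longrightarrow> gyr x y ` N = N"
    and V: "openin X V" "zero \<in> V" "V \<subseteq> N"
    using ex_gyr_invariant_base assms by metis
  let ?U = "X interior_of N"
  have "?U \<subseteq> gyr x y ` ?U" if xy: "x \<in> topspace X" "y \<in> topspace X" for x y
  proof -
    have bij: "bij_betw (gyr x y) (topspace X) (topspace X)"
      using gyr_automorphism[OF xy] by (simp add: gyro_automorphism_def)
    let ?M = "{z \<in> topspace X. gyr x y z \<in> ?U}"
    have "?M \<subseteq> N"
    proof
      fix z assume z: "z \<in> ?M"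
      then have "gyr x y z \<in> gyr x y ` N"
        using interior_of_subset[of X N] N(3)[OF xy] by auto
      with z bij N(1) show "z \<in> N"
        by (auto simp: bij_betw_def dest: inj_onD)
    qed
    moreover have "openin X ?M"
      using openin_continuous_map_preimage[OF continuous_map_gyr[OF xy]] by simp
    ultimately have M: "?M \<subseteq> ?U"
      by (simp add: interior_of_maximal)
    show ?thesis
    proof
      fix w assume w: "w \<in> ?U"
      then have "w \<in> topspace X"
        using interior_of_subset_topspace by fastforce
      then obtain z where "z \<in> topspace X" "w = gyr x y z"
        using bij by (auto simp: bij_betw_def)
      with w M show "w \<in> gyr x y ` ?U" by auto
    qed
  qed
  moreover have "zero \<in> ?U"
    using V by (auto simp: interior_of_def)
  ultimately have "gyr_neighbourhood ?U"
    by (simp add: gyr_neighbourhood_def)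
  moreover have "?U \<subseteq> W"
    using interior_of_subset N(2) by fastforce
  ultimately show thesis using that by blast
qed

text \<open>The closure of \<open>x \<oplus> U\<close> lies in the given neighbourhood of
  \<open>x\<close> when \<open>U\<close> is gyration-invariant and small: a point of the closure has
  the form \<open>(x \<oplus> v) \<oplus> u\<close> with \<open>v\<close> and \<open>u\<close> in
  \<open>U\<close>, and reassociation puts it into \<open>x \<oplus> (U \<oplus> U)\<close>.\<close>

lemma regular_space: "regular_space X"
  unfolding neighbourhood_base_of_closedin[symmetric] neighbourhood_base_of
proof (intro allI impI)
  fix V x assume "openin X V \<and> x \<in> V"
  then have V: "openin X V" "x \<in> V" and x: "x \<in> topspace X"
    using openin_subset by blast+
  have V0: "openin X {z \<in> topspace X. x \<oplus> z \<in> V}" "zero \<in> {z \<in> topspace X. x \<oplus> z \<in> V}"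
    using openin_translate_preimage(1)[OF V(1) x] V(2) x by auto
  obtain O1 where O1: "openin X O1" "zero \<in> O1"
      "\<And>u v. \<lbrakk>u \<in> O1; v \<in> O1\<rbrakk> \<Longrightarrow> u \<oplus> v \<in> {z \<in> topspace X. x \<oplus> z \<in> V}"
    by (rule ex_neighbourhood_oplus[OF V0]) blast
  obtain U where U: "gyr_neighbourhood U" "U \<subseteq> O1"
    using ex_gyr_neighbourhood O1 by metis
  have Uo: "openin X U" "zero \<in> U" "U \<subseteq> topspace X"
    using U(1) openin_subset by (auto simp: gyr_neighbourhood_def)
  let ?T = "(\<oplus>) x ` U"
  have T: "openin X ?T"
    using openin_translate Uo x by blast
  have "x \<oplus> zero \<in> ?T"
    using Uo by blast
  then have "x \<in> ?T"
    using x by simp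
  moreover have "?T \<subseteq> X closure_of ?T"
    using T by (simp add: closure_of_subset openin_subset)
  moreover have "X closure_of ?T \<subseteq> V"
  proof
    fix y assume y: "y \<in> X closure_of ?T"
    then have yX: "y \<in> topspace X"
      by (simp add: in_closure_of)
    \<comment> \<open>This is the open set of all \<open>z\<close> with
      \<open>y \<in> z \<oplus> U\<close>; it contains \<open>y\<close>, so it meets
      \<open>x \<oplus> U\<close>.\<close>
    let ?M = "{z \<in> topspace X. neg z \<oplus> y \<in> U}"
    have "openin X ?M" "y \<in> ?M"
      using openin_translate_preimage(3)[OF Uo(1) yX] yX Uo by auto
    moreover have "\<forall>N. y \<in> N \<and> openin X N \<longrightarrow> (\<exists>z. z \<in> ?T \<and> z \<in> N)"
      using y unfolding in_closure_of by (rule conjunct2)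
    ultimately obtain z where z: "z \<in> ?T" "z \<in> ?M"
      by meson
    then obtain v where v: "v \<in> U" "z = x \<oplus> v" by blast
    have "y = (x \<oplus> v) \<oplus> (neg z \<oplus> y)"
      using z(2) v(2) yX by auto
    then obtain u where "u \<in> U" "y = x \<oplus> (v \<oplus> u)"
      using gyr_neighbourhood_reassoc[OF U(1) x, of v "neg z \<oplus> y"] z(2) v(1) Uo(3)
      by (metis (no_types, lifting) mem_Collect_eq subsetD)
    then show "y \<in> V"
      using O1(3)[of v u] U(2) v(1) by auto
  qed
  ultimately show "\<exists>T C. openin X T \<and> closedin X C \<and> x \<in> T \<and> T \<subseteq> C \<and> C \<subseteq> V"
    using T closedin_closure_of by blast
qed

end

section \<open>Neighbourhoods controlled by cosets and the countable
  \<open>k\<close>-network\<close>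

locale strongly_topological_gyrogroup_with_strong_subgyrogroup =
  strongly_topological_gyrogroup X oplus gyr +
  topological_gyrogroup_with_strong_subgyrogroup X oplus gyr H
  for X :: "'a topology" and oplus (infixl "\<oplus>" 65) and gyr and H
begin

text \<open>Dependent choice yields a sequence in which \<open>U (Suc n)\<close> is small relative
  to \<open>U n\<close> and lies in \<open>C n\<close>, an open set whose trace on \<open>H\<close>
  is the \<open>n\<close>-th member of a countable base at \<open>zero\<close>.\<close>

lemma ex_neighbourhood_family:
  assumes "first_countable (subtopology X H)"
  obtains \<U> where "countable \<U>" "\<And>U. U \<in> \<U> \<Longrightarrow> gyr_neighbourhood U"
    "\<And>U. U \<in> \<U> \<Longrightarrow> \<exists>U'\<in>\<U>. \<forall>u\<in>U'. \<forall>v\<in>U'. u \<oplus> v \<in> U \<and> neg u \<oplus> v \<in> U"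
    "\<And>V. \<lbrakk>openin X V; zero \<in> V\<rbrakk> \<Longrightarrow> \<exists>U\<in>\<U>. U \<inter> H \<subseteq> V"
proof -
  have "zero \<in> topspace (subtopology X H)"
    using zero_mem by simp
  from bspec[OF assms[unfolded first_countable_def] this]
  obtain \<B> where \<B>: "countable \<B>" "\<forall>B\<in>\<B>. openin (subtopology X H) B"
      "\<forall>V. openin (subtopology X H) V \<and> zero \<in> V \<longrightarrow> (\<exists>B\<in>\<B>. zero \<in> B \<and> B \<subseteq> V)"
    by (elim exE conjE)
  let ?\<B> = "{B \<in> \<B>. zero \<in> B}"
  \<comment> \<open>The enumeration may repeat members, so a finite \<open>?\<B>\<close> is allowed;
    it only has to be nonempty.\<close>
  define B where "B = from_nat_into ?\<B>"
  have "?\<B> \<noteq> {}"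
    using \<B>(3) \<open>zero \<in> topspace (subtopology X H)\<close> openin_topspace by blast
  then have range_B: "range B = ?\<B>"
    unfolding B_def using \<B>(1) by (simp add: range_from_nat_into)
  have "\<exists>C. openin X C \<and> zero \<in> C \<and> C \<inter> H = B n" for n
  proof -
    have "B n \<in> ?\<B>" using range_B by blast
    then have "openin (subtopology X H) (B n)" "zero \<in> B n" using \<B>(2) by auto
    then show ?thesis unfolding openin_subtopology by blast
  qed
  then obtain C where C: "\<And>n. openin X (C n)" "\<And>n. zero \<in> C n" "\<And>n. C n \<inter> H = B n"
    by metis
  have step: "\<exists>U'. gyr_neighbourhood U' \<and>
      ((\<forall>u\<in>U'. \<forall>v\<in>U'. u \<oplus> v \<in> U \<and> neg u \<oplus> v \<in> U) \<and> U' \<subseteq> C n)"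
    if U: "gyr_neighbourhood U" for U n
  proof -
    have Uo: "openin X U" "zero \<in> U"
      using U by (auto simp: gyr_neighbourhood_def)
    obtain V1 where V1: "openin X V1" "zero \<in> V1" "\<And>u v. \<lbrakk>u \<in> V1; v \<in> V1\<rbrakk> \<Longrightarrow> u \<oplus> v \<in> U"
      using ex_neighbourhood_oplus[OF Uo] by metis
    obtain V2 where V2: "openin X V2" "zero \<in> V2" "\<And>u v. \<lbrakk>u \<in> V2; v \<in> V2\<rbrakk> \<Longrightarrow> neg u \<oplus> v \<in> U"
      using ex_neighbourhood_diff[OF Uo] by metis
    have "openin X (V1 \<inter> V2 \<inter> C n)" "zero \<in> V1 \<inter> V2 \<inter> C n"
      using V1 V2 C by auto
    then obtain U' where "gyr_neighbourhood U'" "U' \<subseteq> V1 \<inter> V2 \<inter> C n"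
      using ex_gyr_neighbourhood by metis
    with V1(3) V2(3) show ?thesis by blast
  qed
  have start: "\<exists>U. gyr_neighbourhood U"
    using ex_gyr_neighbourhood[of "topspace X"] by auto
  have "\<exists>U. \<forall>n. gyr_neighbourhood (U n) \<and>
      (\<forall>u\<in>U (Suc n). \<forall>v\<in>U (Suc n). u \<oplus> v \<in> U n \<and> neg u \<oplus> v \<in> U n) \<and> U (Suc n) \<subseteq> C n"
    by (rule dependent_nat_choice[OF start step])
  then obtain U where U: "\<And>n. gyr_neighbourhood (U n)"
      "\<And>n. (\<forall>u\<in>U (Suc n). \<forall>v\<in>U (Suc n). u \<oplus> v \<in> U n \<and> neg u \<oplus> v \<in> U n) \<and> U (Suc n) \<subseteq> C n"
    by blast
  show thesis
  proof (rule that[of "range U"])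
    fix V assume V: "openin X V" "zero \<in> V"
    then have "openin (subtopology X H) (V \<inter> H)" "zero \<in> V \<inter> H"
      using zero_mem by (auto simp: openin_subtopology)
    then obtain n where "B n \<subseteq> V \<inter> H"
      using \<B>(3) range_B by (metis (no_types, lifting) imageE mem_Collect_eq)
    \<comment> \<open>The index is shifted because it is \<open>U (Suc n)\<close>, not
      \<open>U n\<close>, that was chosen inside \<open>C n\<close>.\<close>
    then have "U (Suc n) \<inter> H \<subseteq> V"
      using U(2)[of n] C(3)[of n] by blast
    then show "\<exists>U\<in>range U. U \<inter> H \<subseteq> V" by blast
  next
    fix N assume "N \<in> range U"
    then obtain n where "N = U n" by blast
    then show "\<exists>U'\<in>range U. \<forall>u\<in>U'. \<forall>v\<in>U'. u \<oplus> v \<in> N \<and> neg u \<oplus> v \<in> N"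
      using U(2)[of n] by (intro bexI[of _ "U (Suc n)"]) auto
  qed (use U(1) in auto)
qed

text \<open>The witness is the projection of \<open>x \<oplus> (O1 \<inter> U')\<close>. If
  \<open>x \<oplus> u\<close> shares its coset with \<open>x \<oplus> w\<close> for such a
  \<open>w\<close>, then \<open>u = w \<oplus> h\<close> with \<open>h = neg w \<oplus> u\<close> in
  \<open>U \<inter> H\<close>, so both \<open>w\<close> and \<open>h\<close> lie in
  \<open>O1\<close>.\<close>

lemma neighbourhood_by_coset:
  assumes U: "openin X U'" "zero \<in> U'" "\<And>u v. \<lbrakk>u \<in> U'; v \<in> U'\<rbrakk> \<Longrightarrow> neg u \<oplus> v \<in> U"
    and O1: "openin X O1" "zero \<in> O1" "U \<inter> H \<subseteq> O1"
      "\<And>u v. \<lbrakk>u \<in> O1; v \<in> O1\<rbrakk> \<Longrightarrow> x \<oplus> (u \<oplus> v) \<in> V"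
    and x: "x \<in> topspace X"
  obtains W where "openin (coset_space X (\<oplus>) H) W" "coset x \<in> W"
    "\<And>u. \<lbrakk>u \<in> U'; coset (x \<oplus> u) \<in> W\<rbrakk> \<Longrightarrow> x \<oplus> u \<in> V"
proof (rule that[of "coset ` (\<oplus>) x ` (O1 \<inter> U')"])
  show "openin (coset_space X (\<oplus>) H) (coset ` (\<oplus>) x ` (O1 \<inter> U'))"
    using U O1 x by (intro openin_coset_image openin_translate) auto
  have "coset (x \<oplus> zero) \<in> coset ` (\<oplus>) x ` (O1 \<inter> U')"
    using U O1 by blast
  then show "coset x \<in> coset ` (\<oplus>) x ` (O1 \<inter> U')"
    using x by simp
next
  fix u assume u: "u \<in> U'" "coset (x \<oplus> u) \<in> coset ` (\<oplus>) x ` (O1 \<inter> U')"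
  then obtain w where w: "w \<in> O1" "w \<in> U'" "coset (x \<oplus> u) = coset (x \<oplus> w)" by blast
  have uw: "u \<in> topspace X" "w \<in> topspace X"
    using u w openin_subset[OF U(1)] by auto
  then obtain h where h: "h \<in> H" "u = w \<oplus> h"
    using coset_translate_eqE[OF x _ _ w(3)] by metis
  then have "neg w \<oplus> u = h"
    using uw subset_carrier by auto
  then have "h \<in> O1"
    using U(3)[OF w(2) u(1)] h(1) O1(3) by blast
  then show "x \<oplus> u \<in> V"
    using O1(4)[OF w(1)] h(2) by simp
qed

lemma aleph0_space_extension:
  assumes "first_countable (subtopology X H)" "separable_space (subtopology X H)"
    and "aleph0_space (coset_space X (\<oplus>) H)"
  shows "aleph0_space X"
proof -
  obtain \<P> where \<P>: "countable \<P>" "k_network (coset_space X (\<oplus>) H) \<P>"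
    using assms(3) unfolding aleph0_space_def by blast
  obtain S where S: "countable S" "S \<subseteq> topspace X" "X closure_of S = topspace X"
    using separable_space_extension[OF assms(2) k_network_imp_separable_space[OF \<P>]]
    unfolding separable_space_def by blast
  obtain \<U> where \<U>: "countable \<U>" "\<And>U. U \<in> \<U> \<Longrightarrow> gyr_neighbourhood U"
    "\<And>U. U \<in> \<U> \<Longrightarrow> \<exists>U'\<in>\<U>. \<forall>u\<in>U'. \<forall>v\<in>U'. u \<oplus> v \<in> U \<and> neg u \<oplus> v \<in> U"
    "\<And>V. \<lbrakk>openin X V; zero \<in> V\<rbrakk> \<Longrightarrow> \<exists>U\<in>\<U>. U \<inter> H \<subseteq> V"
    using ex_neighbourhood_family[OF assms(1)] by metis
  have \<U>o: "openin X U" "zero \<in> U" "U \<subseteq> topspace X" if "U \<in> \<U>" for U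
    using \<U>(2)[OF that] openin_subset by (auto simp: gyr_neighbourhood_def)
  \<comment> \<open>By left cancellation this is the translate \<open>s \<oplus> U\<close>, written
    as a preimage.\<close>
  define nbhd where "nbhd = (\<lambda>(s, U). {z \<in> topspace X. neg s \<oplus> z \<in> U})"
  have base: "\<exists>A\<in>nbhd ` (S \<times> \<U>). \<exists>W. openin X A \<and> openin (coset_space X (\<oplus>) H) W \<and>
      x \<in> A \<and> coset x \<in> W \<and> {z \<in> A. coset z \<in> W} \<subseteq> V"
    if V: "openin X V" "x \<in> V" for x V
  proof -
    have x: "x \<in> topspace X"
      using V openin_subset by blast
    let ?V = "{z \<in> topspace X. x \<oplus> z \<in> V}"
    have "openin X ?V" "zero \<in> ?V"
      using openin_translate_preimage(1)[OF V(1) x] V(2) x by auto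
    then obtain O1 where O1: "openin X O1" "zero \<in> O1" "\<And>u v. \<lbrakk>u \<in> O1; v \<in> O1\<rbrakk> \<Longrightarrow> u \<oplus> v \<in> ?V"
      by (rule ex_neighbourhood_oplus) blast
    \<comment> \<open>Three scales are needed: the trace of \<open>U1\<close> on \<open>H\<close> is
      small, differences from \<open>U2\<close> lie in \<open>U1\<close>, and sums from
      \<open>U3\<close> lie in \<open>U2\<close>, which absorbs the change of centre from
      \<open>x\<close> to \<open>s\<close>.\<close>
    obtain U1 where U1: "U1 \<in> \<U>" "U1 \<inter> H \<subseteq> O1"
      using \<U>(4)[OF O1(1,2)] by blast
    obtain U2 where U2: "U2 \<in> \<U>" "\<And>u v. \<lbrakk>u \<in> U2; v \<in> U2\<rbrakk> \<Longrightarrow> neg u \<oplus> v \<in> U1"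
      using \<U>(3)[OF U1(1)] by blast
    obtain U3 where U3: "U3 \<in> \<U>" "\<And>u v. \<lbrakk>u \<in> U3; v \<in> U3\<rbrakk> \<Longrightarrow> u \<oplus> v \<in> U2"
      using \<U>(3)[OF U2(1)] by blast
    obtain W where W: "openin (coset_space X (\<oplus>) H) W" "coset x \<in> W"
      "\<And>u. \<lbrakk>u \<in> U2; coset (x \<oplus> u) \<in> W\<rbrakk> \<Longrightarrow> x \<oplus> u \<in> V"
      using neighbourhood_by_coset[OF \<U>o(1,2)[OF U2(1)] U2(2) O1(1,2) U1(2) _ x, of V] O1(3)
      by auto
    \<comment> \<open>The first condition on \<open>s\<close> will place
      \<open>s \<oplus> U3\<close> inside \<open>x \<oplus> U2\<close>; the second says that
      \<open>x \<in> s \<oplus> U3\<close>. Both are imposed because \<open>U3\<close> need not be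
      symmetric.\<close>
    let ?M = "{z \<in> topspace X. neg x \<oplus> z \<in> U3} \<inter> {z \<in> topspace X. neg z \<oplus> x \<in> U3}"
    have "openin X ?M" "x \<in> ?M"
      using openin_translate_preimage[OF \<U>o(1)[OF U3(1)]] x \<U>o(2)[OF U3(1)] by auto
    then have "S \<inter> ?M \<noteq> {}"
      using S(3) unfolding dense_intersects_open by blast
    then obtain s where s: "s \<in> S" "s \<in> topspace X" "neg x \<oplus> s \<in> U3" "neg s \<oplus> x \<in> U3" by blast
    let ?A = "nbhd (s, U3)"
    have "{z \<in> ?A. coset z \<in> W} \<subseteq> V"
    proof
      fix z assume "z \<in> {z \<in> ?A. coset z \<in> W}"
      then have z: "z \<in> topspace X" "neg s \<oplus> z \<in> U3" "coset z \<in> W"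
        by (auto simp: nbhd_def)
      \<comment> \<open>Inserting \<open>s\<close> through \<open>x\<close> prepares the
        reassociation, which exhibits \<open>z\<close> as \<open>x\<close> plus a sum of two
        elements of \<open>U3\<close>, hence as a point of \<open>x \<oplus> U2\<close>.\<close>
      have "z = (x \<oplus> (neg x \<oplus> s)) \<oplus> (neg s \<oplus> z)"
        using z(1) s(2) x by simp
      then obtain u where "u \<in> U3" "z = x \<oplus> ((neg x \<oplus> s) \<oplus> u)"
        using gyr_neighbourhood_reassoc[OF \<U>(2)[OF U3(1)] x, of "neg x \<oplus> s" "neg s \<oplus> z"]
          z(2) s(3) \<U>o(3)[OF U3(1)] by (metis subsetD)
      then show "z \<in> V"
        using W(3) U3(2) s(3) z(3) by metis
    qed
    moreover have "openin X ?A" "x \<in> ?A"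
      using openin_translate_preimage(1)[OF \<U>o(1)[OF U3(1)] neg_closed[OF s(2)]] s(4) x
      by (auto simp: nbhd_def)
    moreover have "?A \<in> nbhd ` (S \<times> \<U>)"
      using s(1) U3(1) by (intro imageI SigmaI)
    ultimately show ?thesis
      using W(1,2) by (intro bexI[of _ ?A] exI[of _ W] conjI)
  qed
  have "countable (nbhd ` (S \<times> \<U>))"
    using S(1) \<U>(1) by simp
  from countable_k_network_pullback[OF regular_space
      quotient_imp_continuous_map[OF quotient_map_left_coset] this \<P> base]
  have "\<exists>\<Q>. countable \<Q> \<and> k_network X \<Q>" .
  then show ?thesis
    using Hausdorff regular_space by (simp add: aleph0_space_def)
qed

end

theorem corollary6p7:
  fixes X :: "'a topology"
    and oplus :: "'a \<Rightarrow> 'a \<Rightarrow> 'a"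
    and gyr :: "'a \<Rightarrow> 'a \<Rightarrow> 'a \<Rightarrow> 'a"
    and H :: "'a set"
  assumes "strongly_topological_gyrogroup X oplus gyr"
    and "strong_subgyrogroup (topspace X) oplus gyr H"
    and "closedin X H"
    and "first_countable (subtopology X H)"
    and "separable_space (subtopology X H)"
    and "aleph0_space (coset_space X oplus H)"
  shows "aleph0_space X"
proof -
  interpret strongly_topological_gyrogroup X oplus gyr by fact
  interpret strongly_topological_gyrogroup_with_strong_subgyrogroup X oplus gyr H
    by unfold_locales fact
  show ?thesis
    using aleph0_space_extension assms(4-6) by blast
qed

end
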